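(* There exists a universal constant $c_{1}>0$ with the following property. Let $d\in\mathbb{N}$, and let $\mu$ be an isotropic log-concave probability measure on $\mathbb{R}^d$ with a continuous density function $f$. For all $0<\delta<e^{-10d\log d-7}$, $$\mu(\mathbb{R}^{d}\setminus D_{\delta})\leq\alpha_{d}\,\delta(\log\delta^{-1})^{d},$$ where $\alpha_{d}=c_{1}\exp(3d^{2}\log d)$.
   Context: A probability measure is log-concave here if its density is of the form $f=e^{-g}$ with $g:\mathbb{R}^d\to(-\infty,\infty]$ convex. It is isotropic if its centroid is the origin and its covariance matrix is the $d\times d$ identity. $D_{\delta}=\operatorname{Cl}\{x\in\mathbb{R}^{d}:f(x)\geq\delta\}$, where $\operatorname{Cl}$ denotes closure. The universal constant does not depend on $d,\mu,\delta$. *)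

theory Defs
  imports "HOL-Probability.Probability"
begin

text \<open>
  The dimension \<open>d\<close> is bound inside a formula, after the universal constant, so it cannot be a
  type. The space \<open>\<real>\<^sup>d\<close> is the set of extensional functions
  \<open>{..<d} \<rightarrow>\<^sub>E UNIV\<close>, which is both the space of the product measure and the topspace of the
  product topology.
\<close>

definition lborel_dim :: "nat \<Rightarrow> (nat \<Rightarrow> real) measure" where
  "lborel_dim d = Pi\<^sub>M {..<d} (\<lambda>_. lborel)"

definition top_dim :: "nat \<Rightarrow> (nat \<Rightarrow> real) topology" where
  "top_dim d = product_topology (\<lambda>_. euclideanreal) {..<d}"

definition has_density :: "nat \<Rightarrow> (nat \<Rightarrow> real) measure \<Rightarrow> ((nat \<Rightarrow> real) \<Rightarrow> real) \<Rightarrow> bool" where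
  "has_density d \<mu> f \<longleftrightarrow>
     f \<in> borel_measurable (lborel_dim d) \<and>
     (\<forall>x \<in> space (lborel_dim d). 0 \<le> f x) \<and>
     \<mu> = density (lborel_dim d) (\<lambda>x. ennreal (f x))"

text \<open>The convention \<open>0 * \<infinity> = 0\<close> of \<^typ>\<open>ereal\<close> makes the inequality harmless at
  \<open>t = 0\<close> and \<open>t = 1\<close>.\<close>

definition convex_ereal :: "nat \<Rightarrow> ((nat \<Rightarrow> real) \<Rightarrow> ereal) \<Rightarrow> bool" where
  "convex_ereal d g \<longleftrightarrow>
     (\<forall>x \<in> space (lborel_dim d). g x \<noteq> -\<infinity>) \<and>
     (\<forall>x \<in> space (lborel_dim d). \<forall>y \<in> space (lborel_dim d). \<forall>t \<in> {0..1}.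
        g (\<lambda>i\<in>{..<d}. (1 - t) * x i + t * y i) \<le> ereal (1 - t) * g x + ereal t * g y)"

definition exp_minus :: "ereal \<Rightarrow> real" where
  "exp_minus a = (if a = \<infinity> then 0 else exp (- real_of_ereal a))"

definition log_concave_measure :: "nat \<Rightarrow> (nat \<Rightarrow> real) measure \<Rightarrow> bool" where
  "log_concave_measure d \<mu> \<longleftrightarrow>
     (\<exists>g. convex_ereal d g \<and> has_density d \<mu> (\<lambda>x. exp_minus (g x)))"

definition centroid :: "(nat \<Rightarrow> real) measure \<Rightarrow> nat \<Rightarrow> real" where
  "centroid \<mu> i = (\<integral>x. x i \<partial>\<mu>)"

definition covariance_matrix :: "(nat \<Rightarrow> real) measure \<Rightarrow> nat \<Rightarrow> nat \<Rightarrow> real" where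
  "covariance_matrix \<mu> i j = (\<integral>x. (x i - centroid \<mu> i) * (x j - centroid \<mu> j) \<partial>\<mu>)"

text \<open>For a probability measure on \<open>\<real>\<^sup>d\<close> no integrability condition is needed: a
  non-integrable function has Bochner integral \<open>0\<close>, so the diagonal entries being \<open>1\<close> forces every
  coordinate to be square integrable.\<close>

definition isotropic :: "nat \<Rightarrow> (nat \<Rightarrow> real) measure \<Rightarrow> bool" where
  "isotropic d \<mu> \<longleftrightarrow>
     (\<forall>i<d. centroid \<mu> i = 0) \<and>
     (\<forall>i<d. \<forall>j<d. covariance_matrix \<mu> i j = (if i = j then 1 else 0))"

definition superlevel_closure :: "nat \<Rightarrow> ((nat \<Rightarrow> real) \<Rightarrow> real) \<Rightarrow> real \<Rightarrow> (nat \<Rightarrow> real) set" where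
  "superlevel_closure d f \<delta> = top_dim d closure_of {x \<in> topspace (top_dim d). f x \<ge> \<delta>}"

end

theory Submission
  imports Defs
begin

text \<open>
  Write \<open>\<phi> = exp (- g)\<close> for the log-concave version of the density; it agrees with \<open>f\<close> almost
  everywhere, so off \<open>D\<^sub>\<delta>\<close> one has \<open>\<phi> < \<delta>\<close> almost surely, and it suffices to bound the mass of
  the sublevel set \<open>{\<phi> < \<delta>}\<close>.

  Fix any point \<open>x\<^sub>0\<close> with \<open>m = \<phi> x\<^sub>0\<close> so large that \<open>L = ln (m / \<delta>) \<ge> 1\<close>, and let \<open>T\<close> be the
  contraction \<open>T x = (1 - 1/L) x\<^sub>0 + (1/L) x\<close>. Log-concavity says
  \<open>m powr (1 - 1/L) * \<phi> x powr (1/L) \<le> \<phi> (T x)\<close>. Where \<open>\<phi> x < \<delta>\<close>, this gives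
  \<open>\<phi> x \<le> (\<delta> / m) powr (1 - 1/L) * \<phi> (T x) = e * (\<delta> / m) * \<phi> (T x)\<close>. The integral of \<open>\<phi> \<circ> T\<close> is
  \<open>L ^ d\<close> by the change of variables for dilations, and hence (\<open>log_concave_sublevel_mass\<close>)
  \<open>\<mu> {\<phi> < \<delta>} \<le> e * (\<delta> / m) * L ^ d\<close>.
  Any centre \<open>x\<^sub>0\<close> will do, since convexity is used only along segments that
  start at \<open>x\<^sub>0\<close>, and \<open>x\<^sub>0\<close> enters the bound only through \<open>m\<close>.

  Isotropy enters only through the choice of \<open>x\<^sub>0\<close>. By Chebyshev's inequality the cube
  \<open>[-2d, 2d]\<^sup>d\<close> has mass at least \<open>3/4\<close>, and its volume is \<open>(4d)\<^sup>d\<close>; so \<open>\<phi> \<ge> 1 / (2 (4d)\<^sup>d)\<close>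
  somewhere on it (\<open>isotropic_density_large_somewhere\<close>). If \<open>m \<ge> 1\<close>, the factor \<open>1/m\<close> absorbs the
  growth of \<open>L ^ d = (ln m + ln (1/\<delta>)) ^ d\<close>; if \<open>m < 1\<close>, then \<open>L \<le> ln (1/\<delta>)\<close> and \<open>1/m\<close> goes into
  \<open>\<alpha>\<^sub>d\<close>.
\<close>

section \<open>Dilations of Lebesgue measure on a product space\<close>

interpretation lborel_product: product_sigma_finite "\<lambda>_::nat. lborel :: real measure"
  by standard

lemma space_lborel_dim: "space (lborel_dim d) = {..<d} \<rightarrow>\<^sub>E UNIV"
  by (simp add: lborel_dim_def space_PiM)

lemma affine_measurable_lborel_dim:
  "(\<lambda>x. \<lambda>i\<in>{..<d}. a i + c * x i) \<in> lborel_dim d \<rightarrow>\<^sub>M lborel_dim d"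
  unfolding lborel_dim_def by measurable

text \<open>A measure on a finite product is determined by its values on boxes, so this reduces to the
  one-dimensional rule in each coordinate.\<close>

lemma lborel_dim_affine:
  assumes c: "c \<noteq> 0"
  shows "lborel_dim d =
    density (distr (lborel_dim d) (lborel_dim d) (\<lambda>x. \<lambda>i\<in>{..<d}. a i + c * x i)) (\<lambda>_. ennreal \<bar>c\<bar> ^ d)"
proof -
  let ?T = "\<lambda>x. \<lambda>i\<in>{..<d}. a i + c * x i"
  let ?D = "distr (lborel_dim d) (lborel_dim d) ?T"
  note T = affine_measurable_lborel_dim[of a c d]
  have "density ?D (\<lambda>_. ennreal \<bar>c\<bar> ^ d) = Pi\<^sub>M {..<d} (\<lambda>_. lborel)"
  proof (rule lborel_product.PiM_eqI)
    show "sets (density ?D (\<lambda>_. ennreal \<bar>c\<bar> ^ d)) = sets (Pi\<^sub>M {..<d} (\<lambda>_. lborel))"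
      by (simp add: lborel_dim_def)
  next
    fix A :: "nat \<Rightarrow> real set"
    assume A: "\<And>i. i \<in> {..<d} \<Longrightarrow> A i \<in> sets lborel"
    define B where "B i = (\<lambda>x. a i + c * x) -` A i" for i
    have B: "B i \<in> sets lborel" if "i < d" for i
    proof -
      have "(\<lambda>x. a i + c * x) -` A i \<inter> space borel \<in> sets borel"
        by (rule measurable_sets[of _ borel borel]) (use A that in auto)
      then show ?thesis by (simp add: B_def)
    qed
    have box: "Pi\<^sub>E {..<d} A \<in> sets (lborel_dim d)"
      unfolding lborel_dim_def by (rule sets_PiM_I_finite) (use A in auto)
    have "?T -` Pi\<^sub>E {..<d} A \<inter> space (lborel_dim d) = Pi\<^sub>E {..<d} B"
    proof (rule set_eqI)
      fix x
      have "?T x \<in> Pi\<^sub>E {..<d} A \<longleftrightarrow> (\<forall>i<d. x i \<in> B i)"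
        by (simp add: PiE_iff B_def Ball_def)
      then show "x \<in> ?T -` Pi\<^sub>E {..<d} A \<inter> space (lborel_dim d) \<longleftrightarrow> x \<in> Pi\<^sub>E {..<d} B"
        by (simp only: Int_iff vimage_eq space_lborel_dim PiE_iff UNIV_I lessThan_iff) blast
    qed
    moreover have "emeasure (lborel_dim d) (Pi\<^sub>E {..<d} B) = (\<Prod>i<d. emeasure lborel (B i))"
      unfolding lborel_dim_def by (rule lborel_product.emeasure_PiM) (use B in auto)
    ultimately have "emeasure ?D (Pi\<^sub>E {..<d} A) = (\<Prod>i<d. emeasure lborel (B i))"
      by (simp add: emeasure_distr[OF T box])
    then have "emeasure (density ?D (\<lambda>_. ennreal \<bar>c\<bar> ^ d)) (Pi\<^sub>E {..<d} A)
        = ennreal \<bar>c\<bar> ^ d * (\<Prod>i<d. emeasure lborel (B i))"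
      using box by (simp add: emeasure_density nn_integral_cmult_indicator)
    also have "\<dots> = (\<Prod>i<d. ennreal \<bar>c\<bar> * emeasure lborel (B i))"
      by (simp add: prod.distrib)
    also have "\<dots> = (\<Prod>i<d. emeasure lborel (A i))"
    proof (rule prod.cong[OF refl])
      fix i assume i: "i \<in> {..<d}"
      have "emeasure lborel (A i) = emeasure (density (distr lborel borel (\<lambda>x. a i + c * x)) (\<lambda>_. ennreal \<bar>c\<bar>)) (A i)"
        using lborel_real_affine[OF c, of "a i"] by simp
      also have "\<dots> = ennreal \<bar>c\<bar> * emeasure lborel (B i)"
        using A[OF i] by (simp add: emeasure_density nn_integral_cmult_indicator emeasure_distr B_def)
      finally show "ennreal \<bar>c\<bar> * emeasure lborel (B i) = emeasure lborel (A i)" by simp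
    qed
    finally show "emeasure (density ?D (\<lambda>_. ennreal \<bar>c\<bar> ^ d)) (Pi\<^sub>E {..<d} A) = (\<Prod>i\<in>{..<d}. emeasure lborel (A i))" .
  qed simp
  then show ?thesis by (simp add: lborel_dim_def)
qed

lemma nn_integral_lborel_dim_affine:
  assumes F: "F \<in> borel_measurable (lborel_dim d)" and c: "c \<noteq> 0"
  shows "(\<integral>\<^sup>+x. F x \<partial>lborel_dim d)
    = ennreal \<bar>c\<bar> ^ d * (\<integral>\<^sup>+x. F (\<lambda>i\<in>{..<d}. a i + c * x i) \<partial>lborel_dim d)"
  using F affine_measurable_lborel_dim[of a c d] measurable_compose[OF affine_measurable_lborel_dim[of a c d] F]
  by (subst lborel_dim_affine[OF c, of d a])
     (simp add: nn_integral_density nn_integral_distr nn_integral_cmult)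

section \<open>Mass of a sublevel set\<close>

lemma exp_minus_nonneg: "0 \<le> exp_minus a"
  by (simp add: exp_minus_def)

lemma exp_minus_log_concave:
  assumes g: "convex_ereal d g"
    and x: "x \<in> space (lborel_dim d)" and y: "y \<in> space (lborel_dim d)" and t: "t \<in> {0..1}"
  shows "exp_minus (g x) powr (1 - t) * exp_minus (g y) powr t
    \<le> exp_minus (g (\<lambda>i\<in>{..<d}. (1 - t) * x i + t * y i))"
proof (cases "g x = \<infinity> \<or> g y = \<infinity>")
  case True
  then show ?thesis by (auto simp: exp_minus_def)
next
  case False
  let ?z = "\<lambda>i\<in>{..<d}. (1 - t) * x i + t * y i"
  have z: "?z \<in> space (lborel_dim d)" by (simp add: space_lborel_dim)
  obtain a where a: "g x = ereal a"
    using False g x by (cases "g x") (auto simp: convex_ereal_def)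
  obtain b where b: "g y = ereal b"
    using False g y by (cases "g y") (auto simp: convex_ereal_def)
  have le: "g ?z \<le> ereal ((1 - t) * a + t * b)"
    using g x y t a b unfolding convex_ereal_def by fastforce
  have "g ?z \<noteq> -\<infinity>" using g z by (auto simp: convex_ereal_def)
  then obtain w where w: "g ?z = ereal w"
    using le by (cases "g ?z") auto
  then have "w \<le> (1 - t) * a + t * b" using le by simp
  then have "exp (- ((1 - t) * a + t * b)) \<le> exp (- w)" by simp
  moreover have "exp (- a) powr (1 - t) * exp (- b) powr t = exp (- ((1 - t) * a + t * b))"
    by (simp add: powr_def exp_add[symmetric] algebra_simps)
  ultimately show ?thesis by (simp add: exp_minus_def a b w)
qed

text \<open>The exponent \<open>1/L\<close> is chosen so that the loss \<open>(\<delta>/m) powr (1 - 1/L)\<close> exceeds \<open>\<delta>/m\<close> only by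
  the factor \<open>e\<close>, while the contraction by \<open>1/L\<close> costs \<open>L ^ d\<close> in the change of variables.\<close>

lemma log_concave_sublevel_mass:
  assumes prob: "prob_space \<mu>"
    and g: "convex_ereal d g"
    and dens: "has_density d \<mu> (\<lambda>x. exp_minus (g x))"
    and x0: "x0 \<in> space (lborel_dim d)"
    and \<delta>: "0 < \<delta>"
    and m: "0 < exp_minus (g x0)"
    and L: "1 \<le> ln (exp_minus (g x0) / \<delta>)"
  shows "measure \<mu> {x \<in> space \<mu>. exp_minus (g x) < \<delta>}
    \<le> exp 1 * (\<delta> / exp_minus (g x0)) * ln (exp_minus (g x0) / \<delta>) ^ d"
proof -
  define \<phi> where "\<phi> x = exp_minus (g x)" for x
  define m where "m = \<phi> x0"
  define L where "L = ln (m / \<delta>)"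
  define t where "t = 1 / L"
  define T where "T x = (\<lambda>i\<in>{..<d}. (1 - t) * x0 i + t * x i)" for x
  have m_pos: "0 < m" and L1: "1 \<le> L" using m L by (simp_all add: m_def \<phi>_def L_def)
  have t: "0 < t" "t \<le> 1" "t * L = 1" using L1 by (simp_all add: t_def)
  have \<phi>_nonneg: "0 \<le> \<phi> x" for x by (simp add: \<phi>_def exp_minus_nonneg)
  have \<phi>_meas[measurable]: "\<phi> \<in> borel_measurable (lborel_dim d)"
    and \<mu>: "\<mu> = density (lborel_dim d) (\<lambda>x. ennreal (\<phi> x))"
    using dens by (simp_all add: has_density_def \<phi>_def[abs_def])
  have [measurable]: "T \<in> lborel_dim d \<rightarrow>\<^sub>M lborel_dim d"
    using affine_measurable_lborel_dim[of "\<lambda>i. (1 - t) * x0 i" t d] by (simp add: T_def[abs_def])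
  have pointwise: "\<phi> x \<le> exp 1 * (\<delta> / m) * \<phi> (T x)"
    if x: "x \<in> space (lborel_dim d)" and less: "\<phi> x < \<delta>" for x
  proof (cases "\<phi> x = 0")
    case True
    then show ?thesis using \<phi>_nonneg[of "T x"] \<delta> m_pos by simp
  next
    case False
    then have pos: "0 < \<phi> x" using \<phi>_nonneg[of x] by simp
    have lc: "m powr (1 - t) * \<phi> x powr t \<le> \<phi> (T x)"
      using exp_minus_log_concave[OF g x0 x, of t] t by (simp add: m_def \<phi>_def T_def)
    have loss: "(\<delta> / m) powr (1 - t) = exp 1 * (\<delta> / m)"
    proof -
      have "ln (\<delta> / m) = - L" using \<delta> m_pos by (simp add: L_def ln_div)
      moreover have "\<delta> / m = exp (ln (\<delta> / m))" using \<delta> m_pos by simp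
      ultimately have "\<delta> / m = exp (- L)" by simp
      then show ?thesis using t by (simp add: powr_def exp_add[symmetric] algebra_simps)
    qed
    have "\<phi> x = \<phi> x powr (1 - t) * \<phi> x powr t"
      using pos by (simp add: powr_add[symmetric])
    also have "\<dots> \<le> \<delta> powr (1 - t) * \<phi> x powr t"
      using less pos t by (intro mult_right_mono powr_mono2) auto
    also have "\<dots> = (\<delta> / m) powr (1 - t) * (m powr (1 - t) * \<phi> x powr t)"
      using \<delta> m_pos by (simp add: powr_divide)
    also have "\<dots> \<le> (\<delta> / m) powr (1 - t) * \<phi> (T x)"
      using lc by (intro mult_left_mono) auto
    finally show ?thesis by (simp add: loss)
  qed
  have mass: "(\<integral>\<^sup>+x. ennreal (\<phi> x) \<partial>lborel_dim d) = 1"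
    using prob_space.emeasure_space_1[OF prob] by (simp add: \<mu> emeasure_density cong: nn_integral_cong)
  have mass_T: "(\<integral>\<^sup>+x. ennreal (\<phi> (T x)) \<partial>lborel_dim d) = ennreal (L ^ d)"
  proof -
    have "1 = ennreal \<bar>t\<bar> ^ d * (\<integral>\<^sup>+x. ennreal (\<phi> (T x)) \<partial>lborel_dim d)"
      using nn_integral_lborel_dim_affine[of "\<lambda>x. ennreal (\<phi> x)" d t "\<lambda>i. (1 - t) * x0 i"] t mass
      by (simp add: T_def)
    then have "ennreal (L ^ d) * 1 = ennreal (L ^ d) * (ennreal (t ^ d) * (\<integral>\<^sup>+x. ennreal (\<phi> (T x)) \<partial>lborel_dim d))"
      using t by (simp add: ennreal_power)
    also have "\<dots> = ennreal (L ^ d * t ^ d) * (\<integral>\<^sup>+x. ennreal (\<phi> (T x)) \<partial>lborel_dim d)"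
      using t L1 by (simp add: ennreal_mult mult.assoc)
    also have "L ^ d * t ^ d = 1" using t by (simp add: power_mult_distrib[symmetric] mult.commute)
    finally show ?thesis by simp
  qed
  have K: "0 \<le> exp 1 * (\<delta> / m)" using \<delta> m_pos by simp
  have set: "{x \<in> space \<mu>. \<phi> x < \<delta>} \<in> sets (lborel_dim d)"
    by (simp add: \<mu>)
  have "emeasure \<mu> {x \<in> space \<mu>. \<phi> x < \<delta>}
      = (\<integral>\<^sup>+x. ennreal (\<phi> x) * indicator {x \<in> space \<mu>. \<phi> x < \<delta>} x \<partial>lborel_dim d)"
    using set by (subst (1) \<mu>) (simp add: emeasure_density)
  also have "\<dots> \<le> (\<integral>\<^sup>+x. ennreal (exp 1 * (\<delta> / m)) * ennreal (\<phi> (T x)) \<partial>lborel_dim d)"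
  proof (rule nn_integral_mono)
    fix x assume x: "x \<in> space (lborel_dim d)"
    show "ennreal (\<phi> x) * indicator {x \<in> space \<mu>. \<phi> x < \<delta>} x \<le> ennreal (exp 1 * (\<delta> / m)) * ennreal (\<phi> (T x))"
      using pointwise[OF x] K \<phi>_nonneg[of "T x"]
      by (auto simp: ennreal_mult'[symmetric] intro!: ennreal_leI split: split_indicator)
  qed
  also have "\<dots> = ennreal (exp 1 * (\<delta> / m)) * ennreal (L ^ d)"
    by (simp add: nn_integral_cmult mass_T)
  also have "\<dots> = ennreal (exp 1 * (\<delta> / m) * L ^ d)"
    by (rule ennreal_mult'[symmetric]) (rule K)
  finally have "measure \<mu> {x \<in> space \<mu>. \<phi> x < \<delta>} \<le> exp 1 * (\<delta> / m) * L ^ d"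
    using mult_nonneg_nonneg[OF K, of "L ^ d"] L1 unfolding measure_def by (intro enn2real_leI) auto
  then show ?thesis by (simp add: \<phi>_def m_def L_def)
qed

section \<open>A point of large density\<close>

text \<open>Chebyshev's inequality in each coordinate, with \<open>d / (2d)\<^sup>2 \<le> 1/4\<close>.\<close>

lemma isotropic_cube_mass:
  assumes prob: "prob_space \<mu>" and sets: "sets \<mu> = sets (lborel_dim d)"
    and iso: "isotropic d \<mu>" and d: "1 \<le> d"
  shows "3 / 4 \<le> measure \<mu> ({..<d} \<rightarrow>\<^sub>E {- (2 * real d) .. 2 * real d})"
proof -
  interpret prob_space \<mu> by (rule prob)
  have space: "space \<mu> = {..<d} \<rightarrow>\<^sub>E UNIV"
    using sets_eq_imp_space_eq[OF sets] by (simp add: space_lborel_dim)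
  have [measurable]: "(\<lambda>x. x i) \<in> borel_measurable \<mu>" if "i < d" for i
    using that by (subst measurable_cong_sets[OF sets refl]) (simp add: lborel_dim_def)
  define A where "A i = {x \<in> space \<mu>. 2 * real d \<le> \<bar>x i\<bar>}" for i
  let ?Q = "{..<d} \<rightarrow>\<^sub>E {- (2 * real d) .. 2 * real d}"
  have tail: "prob (A i) \<le> 1 / (2 * real d)\<^sup>2" if i: "i < d" for i
  proof -
    have var: "(\<integral>x. (x i)\<^sup>2 \<partial>\<mu>) = 1"
    proof -
      have "centroid \<mu> i = 0" "covariance_matrix \<mu> i i = 1"
        using iso i by (auto simp: isotropic_def)
      then show ?thesis by (simp add: covariance_matrix_def power2_eq_square)
    qed
    then have "integrable \<mu> (\<lambda>x. (x i)\<^sup>2)"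
      using not_integrable_integral_eq by fastforce
    then show ?thesis
      using second_moment_method[of "\<lambda>x. x i" "2 * real d"] i d by (simp add: var A_def)
  qed
  have A_ev: "A i \<in> events" if "i < d" for i
    using that unfolding A_def by measurable
  have Q: "?Q \<in> events"
    unfolding sets lborel_dim_def by (rule sets_PiM_I_finite) auto
  have "prob (\<Union>i<d. A i) \<le> (\<Sum>i<d. prob (A i))"
    using A_ev by (intro finite_measure_subadditive_finite) auto
  also have "\<dots> \<le> (\<Sum>i<d. 1 / (2 * real d)\<^sup>2)"
    by (intro sum_mono tail) simp
  also have "\<dots> \<le> 1 / 4"
    using d by (simp add: power2_eq_square field_simps)
  finally have "prob (\<Union>i<d. A i) \<le> 1 / 4" .
  moreover have "space \<mu> - ?Q \<subseteq> (\<Union>i<d. A i)"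
  proof
    fix x assume "x \<in> space \<mu> - ?Q"
    then obtain i where "i < d" "x i \<notin> {- (2 * real d) .. 2 * real d}" and x: "x \<in> space \<mu>"
      by (auto simp: space PiE_iff)
    then have "x \<in> A i" by (auto simp: A_def)
    then show "x \<in> (\<Union>i<d. A i)" using \<open>i < d\<close> by auto
  qed
  then have "prob (space \<mu> - ?Q) \<le> prob (\<Union>i<d. A i)"
    using A_ev by (intro finite_measure_mono) auto
  ultimately show ?thesis using prob_compl[OF Q] by simp
qed

text \<open>A density below half the reciprocal of the volume of the cube would give the cube mass at
  most \<open>1/2\<close>, against the \<open>3/4\<close> just obtained.\<close>

lemma isotropic_density_large_somewhere:
  assumes prob: "prob_space \<mu>" and dens: "has_density d \<mu> \<phi>"
    and iso: "isotropic d \<mu>" and d: "1 \<le> d"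
  obtains x where "x \<in> space (lborel_dim d)" "1 / (2 * (4 * real d) ^ d) \<le> \<phi> x"
proof (rule ccontr)
  let ?Q = "{..<d} \<rightarrow>\<^sub>E {- (2 * real d) .. 2 * real d}"
  let ?b = "1 / (2 * (4 * real d) ^ d)"
  assume "\<not> thesis"
  with that have small: "\<phi> x < ?b" if "x \<in> space (lborel_dim d)" for x
    using that by (meson not_le_imp_less)
  interpret prob_space \<mu> by (rule prob)
  have [measurable]: "\<phi> \<in> borel_measurable (lborel_dim d)"
    and \<mu>: "\<mu> = density (lborel_dim d) (\<lambda>x. ennreal (\<phi> x))"
    using dens by (simp_all add: has_density_def)
  have sets: "sets \<mu> = sets (lborel_dim d)" by (simp add: \<mu>)
  have Q: "?Q \<in> sets (lborel_dim d)"
    unfolding lborel_dim_def by (rule sets_PiM_I_finite) auto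
  have "emeasure \<mu> ?Q = (\<integral>\<^sup>+x. ennreal (\<phi> x) * indicator ?Q x \<partial>lborel_dim d)"
    using Q by (subst \<mu>) (simp add: emeasure_density)
  also have "\<dots> \<le> (\<integral>\<^sup>+x. ennreal ?b * indicator ?Q x \<partial>lborel_dim d)"
    using small by (intro nn_integral_mono mult_right_mono ennreal_leI) (auto intro: less_imp_le)
  also have "\<dots> = ennreal ?b * emeasure (lborel_dim d) ?Q"
    using Q by (rule nn_integral_cmult_indicator)
  also have "emeasure (lborel_dim d) ?Q = (\<Prod>i<d. emeasure lborel {- (2 * real d) .. 2 * real d})"
    unfolding lborel_dim_def by (rule lborel_product.emeasure_PiM) auto
  also have "\<dots> = ennreal ((4 * real d) ^ d)"
    by (simp add: ennreal_power)
  also have "ennreal ?b * \<dots> = ennreal (?b * (4 * real d) ^ d)"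
    by (rule ennreal_mult[symmetric]) auto
  also have "?b * (4 * real d) ^ d = 1 / 2"
    using d by simp
  finally have "prob ?Q \<le> 1 / 2"
    unfolding measure_def by (intro enn2real_leI) auto
  with isotropic_cube_mass[OF prob sets iso d] show False by simp
qed

section \<open>Constants\<close>

lemma le_two_times_self_times_ln:
  assumes "1 \<le> d"
  shows "d = 1 \<or> real d \<le> 2 * (real d * ln (real d))"
proof (cases "d = 1")
  case False
  then have "ln 2 \<le> ln (real d)" using assms by simp
  then have "1 / 2 \<le> ln (real d)" using ln2_ge_two_thirds by linarith
  then have "real d * (1 / 2) \<le> real d * ln (real d)"
    by (intro mult_left_mono) auto
  then show ?thesis by simp
qed simp

text \<open>Twice the volume of the cube, absorbed into a power of \<open>d\<close>: for \<open>d \<ge> 2\<close> one has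
  \<open>4 \<le> d\<^sup>2\<close>, and the constant \<open>8\<close> is what \<open>d = 1\<close> requires.\<close>

lemma cube_volume_bound:
  assumes d: "1 \<le> d"
  shows "2 * (4 * real d) ^ d \<le> 8 * exp (3 * real d * ln (real d))"
proof (cases "d = 1")
  case False
  then have "2 \<le> real d" using d by linarith
  then have "4 \<le> real d ^ 2" using power_mono[of 2 "real d" 2] by simp
  then have "4 * real d \<le> real d ^ 3"
    using mult_right_mono[of 4 "real d ^ 2" "real d"] by (simp add: eval_nat_numeral)
  then have "(4 * real d) ^ d \<le> (real d ^ 3) ^ d"
    by (intro power_mono) auto
  also have "\<dots> = real d powr real (3 * d)"
    using d by (subst powr_realpow) (auto simp: power_mult)
  also have "\<dots> = exp (3 * real d * ln (real d))"
    using d by (simp add: powr_def)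
  finally have "(4 * real d) ^ d \<le> exp (3 * real d * ln (real d))" .
  moreover have "0 \<le> exp (3 * real d * ln (real d))" by simp
  ultimately show ?thesis by linarith
qed simp

text \<open>When \<open>m \<ge> 1\<close> the extra logarithm is absorbed by
  \<open>(1 + ln m / l) ^ d \<le> exp (d * ln m / l) \<le> m\<close>, since \<open>d \<le> l\<close>.\<close>

lemma log_power_absorb:
  fixes m l b :: real
  assumes m: "0 < m" and d: "real d \<le> l" and l: "0 < l" and L: "0 \<le> ln m + l"
    and b: "1 / m \<le> b" "1 \<le> b"
  shows "(ln m + l) ^ d / m \<le> b * l ^ d"
proof (cases "1 \<le> m")
  case True
  have "(ln m + l) ^ d = l ^ d * (1 + ln m / l) ^ d"
    using l by (simp add: power_mult_distrib[symmetric] field_simps)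
  also have "\<dots> \<le> l ^ d * exp (ln m / l) ^ d"
    using l True by (intro mult_left_mono power_mono exp_ge_add_one_self) auto
  also have "\<dots> = l ^ d * exp (real d * ln m / l)"
    by (simp add: exp_of_nat_mult[symmetric])
  also have "\<dots> \<le> l ^ d * exp (ln m)"
  proof -
    have "real d * ln m / l \<le> ln m"
      using d l True by (simp add: field_simps mult_right_mono)
    then show ?thesis using l by (intro mult_left_mono) auto
  qed
  also have "\<dots> = l ^ d * m" using m by simp
  finally have "(ln m + l) ^ d / m \<le> l ^ d" using m by (simp add: field_simps)
  also have "\<dots> \<le> b * l ^ d" using b l by simp
  finally show ?thesis .
next
  case False
  then have "(ln m + l) ^ d \<le> l ^ d" using m L by (intro power_mono) auto
  then have "(1 / m) * (ln m + l) ^ d \<le> b * l ^ d"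
    using b m l L by (intro mult_mono) auto
  then show ?thesis by simp
qed

theorem lemma16:
  "\<exists>c\<^sub>1::real. c\<^sub>1 > 0 \<and>
     (\<forall>(d::nat) (\<mu> :: (nat \<Rightarrow> real) measure) (f :: (nat \<Rightarrow> real) \<Rightarrow> real) (\<delta>::real).
        d \<ge> 1 \<longrightarrow>
        prob_space \<mu> \<longrightarrow>
        log_concave_measure d \<mu> \<longrightarrow>
        isotropic d \<mu> \<longrightarrow>
        has_density d \<mu> f \<longrightarrow>
        continuous_map (top_dim d) euclideanreal f \<longrightarrow>
        0 < \<delta> \<longrightarrow>
        \<delta> < exp (- 10 * real d * ln (real d) - 7) \<longrightarrow>
        measure \<mu> (space \<mu> - superlevel_closure d f \<delta>)
          \<le> (c\<^sub>1 * exp (3 * (real d)\<^sup>2 * ln (real d))) * \<delta> * (ln (inverse \<delta>)) ^ d)"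
proof (intro exI[of _ "8 * exp 1"] conjI allI impI)
  show "0 < (8 * exp 1 :: real)" by simp
next
  fix d :: nat and \<mu> :: "(nat \<Rightarrow> real) measure" and f :: "(nat \<Rightarrow> real) \<Rightarrow> real" and \<delta> :: real
  assume d: "1 \<le> d" and prob: "prob_space \<mu>" and lc: "log_concave_measure d \<mu>"
    and iso: "isotropic d \<mu>" and f: "has_density d \<mu> f"
    and \<delta>: "0 < \<delta>" and \<delta>_small: "\<delta> < exp (- 10 * real d * ln (real d) - 7)"
  interpret prob_space \<mu> by (rule prob)
  obtain g where g: "convex_ereal d g" and dens: "has_density d \<mu> (\<lambda>x. exp_minus (g x))"
    using lc by (auto simp: log_concave_measure_def)
  define \<phi> where "\<phi> x = exp_minus (g x)" for x
  have \<phi>_dens: "has_density d \<mu> \<phi>" using dens by (simp add: \<phi>_def[abs_def])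
  have [measurable]: "\<phi> \<in> borel_measurable (lborel_dim d)" "f \<in> borel_measurable (lborel_dim d)"
    and \<mu>: "\<mu> = density (lborel_dim d) (\<lambda>x. ennreal (\<phi> x))"
    and \<mu>f: "\<mu> = density (lborel_dim d) (\<lambda>x. ennreal (f x))"
    and f_nonneg: "\<And>x. x \<in> space (lborel_dim d) \<Longrightarrow> 0 \<le> f x"
    using \<phi>_dens f by (simp_all add: has_density_def)
  have space: "space \<mu> = space (lborel_dim d)" by (simp add: \<mu>)
  have "AE x in lborel_dim d. ennreal (\<phi> x) = ennreal (f x)"
    using sigma_finite_density_unique[of "\<lambda>x. ennreal (\<phi> x)" "lborel_dim d" "\<lambda>x. ennreal (f x)"]
      sigma_finite_measure_axioms \<mu> \<mu>f by simp
  then have "AE x in lborel_dim d. \<phi> x = f x"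
    using AE_space by eventually_elim (use f_nonneg in \<open>auto simp: \<phi>_def exp_minus_nonneg\<close>)
  then have ae: "AE x in \<mu>. \<phi> x = f x"
    unfolding \<mu> by (subst AE_density) auto
  have D: "{x \<in> space \<mu>. \<delta> \<le> f x} \<subseteq> superlevel_closure d f \<delta>"
    unfolding superlevel_closure_def space space_lborel_dim
    using closure_of_subset[of "{x \<in> topspace (top_dim d). \<delta> \<le> f x}" "top_dim d"]
    by (simp add: top_dim_def)
  have "AE x in \<mu>. x \<in> space \<mu> - superlevel_closure d f \<delta> \<longrightarrow> x \<in> {x \<in> space \<mu>. \<phi> x < \<delta>}"
    using ae by eventually_elim (use D in \<open>auto simp: not_le[symmetric]\<close>)
  then have reduce: "prob (space \<mu> - superlevel_closure d f \<delta>) \<le> prob {x \<in> space \<mu>. \<phi> x < \<delta>}"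
    by (rule finite_measure_mono_AE) (simp add: \<mu>)
  obtain x0 where x0: "x0 \<in> space (lborel_dim d)" and x0_large: "1 / (2 * (4 * real d) ^ d) \<le> \<phi> x0"
    using isotropic_density_large_somewhere[OF prob \<phi>_dens iso d] .
  define m where "m = \<phi> x0"
  define l where "l = ln (1 / \<delta>)"
  let ?E = "exp (3 * real d * ln (real d))"
  have vol_pos: "0 < 2 * (4 * real d) ^ d" using d by simp
  then have m: "0 < m" using x0_large less_le_trans[of 0 "1 / (2 * (4 * real d) ^ d)" m]
    by (simp add: m_def)
  have "1 / m \<le> 2 * (4 * real d) ^ d"
    using x0_large m vol_pos by (simp add: m_def field_simps)
  then have inv_m: "1 / m \<le> 8 * ?E" using cube_volume_bound[OF d] by linarith
  have l: "10 * (real d * ln (real d)) + 7 \<le> l"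
  proof -
    have "ln \<delta> \<le> - 10 * real d * ln (real d) - 7"
      using \<delta> \<delta>_small ln_less_cancel_iff[of \<delta> "exp (- 10 * real d * ln (real d) - 7)"] by simp
    then show ?thesis using \<delta> by (simp add: l_def ln_div)
  qed
  have dlnd: "0 \<le> real d * ln (real d)" using d by simp
  have ln_m: "- (3 + 3 * (real d * ln (real d))) \<le> ln m"
  proof -
    \<comment> \<open>since \<open>8 = 2 ^ 3 \<le> e ^ 3\<close>\<close>
    have "2 ^ 3 \<le> (exp 1 :: real) ^ 3"
      using exp_ge_add_one_self[of "1::real"] by (intro power_mono) auto
    then have "8 * ?E \<le> exp 3 * ?E" by (simp add: exp_of_nat_mult[symmetric])
    with inv_m have "1 / m \<le> exp 3 * ?E" by (rule order_trans)
    then have "1 / m \<le> exp (3 + 3 * real d * ln (real d))"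
      by (simp only: exp_add)
    then have "ln (1 / m) \<le> ln (exp (3 + 3 * real d * ln (real d)))"
      using m by (subst ln_le_cancel_iff) auto
    then show ?thesis using m by (simp add: ln_div)
  qed
  have L_eq: "ln (m / \<delta>) = ln m + l" using m \<delta> by (simp add: l_def ln_div)
  have L: "1 \<le> ln m + l" using ln_m l dlnd by linarith
  have d_le: "real d \<le> l" using le_two_times_self_times_ln[OF d] l dlnd by auto
  have "prob {x \<in> space \<mu>. \<phi> x < \<delta>} \<le> exp 1 * (\<delta> / m) * (ln m + l) ^ d"
    using log_concave_sublevel_mass[OF prob g dens x0 \<delta>] m L L_eq by (simp add: \<phi>_def m_def)
  also have "\<dots> = exp 1 * \<delta> * ((ln m + l) ^ d / m)" by simp
  also have "\<dots> \<le> exp 1 * \<delta> * (8 * exp (3 * (real d)\<^sup>2 * ln (real d)) * l ^ d)"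
  proof (intro mult_left_mono log_power_absorb)
    have "real d * ln (real d) \<le> (real d)\<^sup>2 * ln (real d)"
      using d by (intro mult_right_mono) (auto simp: power2_eq_square)
    then show "1 / m \<le> 8 * exp (3 * (real d)\<^sup>2 * ln (real d))"
      using inv_m by (elim order_trans) simp
    have "0 \<le> 3 * (real d)\<^sup>2 * ln (real d)" using d by simp
    then have "1 \<le> exp (3 * (real d)\<^sup>2 * ln (real d))" by simp
    then show "1 \<le> 8 * exp (3 * (real d)\<^sup>2 * ln (real d))" by linarith
  qed (use m \<delta> l dlnd L d_le in auto)
  finally show "prob (space \<mu> - superlevel_closure d f \<delta>)
      \<le> 8 * exp 1 * exp (3 * (real d)\<^sup>2 * ln (real d)) * \<delta> * ln (inverse \<delta>) ^ d"
    using reduce by (simp add: l_def inverse_eq_divide mult_ac)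
qed

end
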